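(* Let $\mathcal{X}\in\mathbb{R}^{s_1\times\cdots\times s_N}$ be a tensor and let $A^{(l)}=A_p^{(l)}+dA^{(l)}\in\mathbb{R}^{s_l\times R}$, $l\in\{1,\ldots,N\}$, be the current CP factor matrices, where $A_p^{(l)}$ are the factor matrices at the time the pairwise perturbation operators were formed. Suppose $\|da_k^{(l)}\|_2/\|a_k^{(l)}\|_2\le\epsilon\ll1$ for all $l\in\{1,\ldots,N\}$ and $k\in\{1,\ldots,R\}$, and let $n\in\{1,\ldots,N\}$ be such that $s_m\le s_n$ for all $m\in\{1,\ldots,N\}$. Then the pairwise perturbation algorithm without second order corrections computes $\tilde M^{(n)}$ with column-wise error, for each $k\in\{1,\ldots,R\}$, $$\frac{\|\tilde m_k^{(n)}-m_k^{(n)}\|_2}{\|m_k^{(n)}\|_2}=O\big(\epsilon^2\kappa(\mathcal{X})\big),$$ where $M^{(n)}$ is the MTTKRP matrix given by a regular ALS sweep, and $m_k^{(n)},\tilde m_k^{(n)}$ are the $k$-th columns of $M^{(n)},\tilde M^{(n)}$.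
   Context: Lower-case $a_k^{(l)},da_k^{(l)}$ denote the $k$-th columns of $A^{(l)},dA^{(l)}$; $a_{p,k}^{(l)}$ is the $k$-th column of $A_p^{(l)}$. The $k$-th column $m_k^{(n)}$ of the MTTKRP $M^{(n)}$ is the contraction of $\mathcal{X}$ with $a_k^{(j)}$ along every mode $j\ne n$. Let $m_{p,k}^{(n)}$ be the contraction of $\mathcal{X}$ with $a_{p,k}^{(j)}$ along every mode $j\ne n$, and $\mathcal{M}_p^{(i,n)}(\cdot,\cdot,k)\in\mathbb{R}^{s_i\times s_n}$ the contraction of $\mathcal{X}$ with $a_{p,k}^{(j)}$ along every mode $j\notin\{i,n\}$. Pairwise perturbation without second order corrections computes $$\tilde m_k^{(n)}(y)=m_{p,k}^{(n)}(y)+\sum_{i\ne n}\sum_{x=1}^{s_i}\mathcal{M}_p^{(i,n)}(x,y,k)\,dA^{(i)}(x,k).$$ Tensor condition number: for $\mathcal{T}\in\mathbb{R}^{s_1\times\cdots\times s_N}$ put, for nonzero vectors $x^{(i)}\in\mathbb{R}^{s_i}$, $$f_{\mathcal{T}}(x^{(2)},\ldots,x^{(N)})=\frac{\|\mathcal{T}\times_2x^{(2)T}\cdots\times_Nx^{(N)T}\|_2}{\|x^{(2)}\|_2\cdots\|x^{(N)}\|_2},$$ where $\times_ix^{(i)T}$ is contraction of mode $i$ with $x^{(i)}$, and $\kappa(\mathcal{T})=\sup f_{\mathcal{T}}/\inf f_{\mathcal{T}}$, with $\kappa(\mathcal{T})=+\infty$ if $\inf f_{\mathcal{T}}=0$ (in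 which case the asserted bound is vacuous). $O(\epsilon^2\kappa(\mathcal{X}))$ means: bounded by $C\epsilon^2\kappa(\mathcal{X})$ for all sufficiently small $\epsilon$, with $C$ and the smallness threshold depending only on $N$. *)

theory Defs
  imports "HOL-Analysis.Analysis"
begin

text \<open>
  The order \<open>N\<close> and the dimensions \<open>s 1, \<dots>, s N\<close> vary inside the theorem, so all objects
  are functions on 1-based index ranges; values outside these ranges are never used. A tensor
  is a real function of multi-indices from \<open>\<Pi>\<^sub>E l\<in>{1..N}. {1..s l}\<close>, a vector of length \<open>d\<close> is a
  function on \<open>{1..d}\<close> with Euclidean norm \<open>L2_set v {1..d}\<close>, and a family of factor matrices
  \<open>B\<close> has the entries \<open>B l x k\<close> (mode \<open>l\<close>, row \<open>x\<close>, column \<open>k\<close>).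
\<close>

type_synonym tensor = "(nat \<Rightarrow> nat) \<Rightarrow> real"

definition nonzero_vec :: "nat \<Rightarrow> (nat \<Rightarrow> real) \<Rightarrow> bool" where
  "nonzero_vec d v \<longleftrightarrow> (\<exists>x\<in>{1..d}. v x \<noteq> 0)"

text \<open>
  Contraction of \<open>X\<close> with the vectors \<open>v j\<close> along every mode \<open>j \<in> J\<close>. The result is a tensor in
  the remaining modes: its argument \<open>y\<close> is a multi-index on the complement of \<open>J\<close>,
  \<open>undefined\<close> elsewhere.
\<close>

definition tensor_contract ::
  "(nat \<Rightarrow> nat) \<Rightarrow> tensor \<Rightarrow> nat set \<Rightarrow> (nat \<Rightarrow> nat \<Rightarrow> real) \<Rightarrow> tensor" where
  "tensor_contract s X J v y =
     (\<Sum>h\<in>(\<Pi>\<^sub>E j\<in>J. {1..s j}). X (override_on y h J) * (\<Prod>j\<in>J. v j (h j)))"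

definition mttkrp_col ::
  "nat \<Rightarrow> (nat \<Rightarrow> nat) \<Rightarrow> tensor \<Rightarrow> (nat \<Rightarrow> nat \<Rightarrow> nat \<Rightarrow> real) \<Rightarrow> nat \<Rightarrow> nat \<Rightarrow> nat \<Rightarrow> real" where
  "mttkrp_col N s X B n k y =
     tensor_contract s X ({1..N} - {n}) (\<lambda>j x. B j x k) (\<lambda>l\<in>{n}. y)"

text \<open>Entry \<open>(x, y, k)\<close> of the pairwise perturbation operator of modes \<open>i \<noteq> n\<close>.\<close>

definition pp_operator ::
  "nat \<Rightarrow> (nat \<Rightarrow> nat) \<Rightarrow> tensor \<Rightarrow> (nat \<Rightarrow> nat \<Rightarrow> nat \<Rightarrow> real) \<Rightarrow>
   nat \<Rightarrow> nat \<Rightarrow> nat \<Rightarrow> nat \<Rightarrow> nat \<Rightarrow> real" where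
  "pp_operator N s X Ap i n x y k =
     tensor_contract s X ({1..N} - {i, n}) (\<lambda>j x. Ap j x k) (\<lambda>l\<in>{i, n}. if l = i then x else y)"

definition pp_mttkrp_col ::
  "nat \<Rightarrow> (nat \<Rightarrow> nat) \<Rightarrow> tensor \<Rightarrow> (nat \<Rightarrow> nat \<Rightarrow> nat \<Rightarrow> real) \<Rightarrow>
   (nat \<Rightarrow> nat \<Rightarrow> nat \<Rightarrow> real) \<Rightarrow> nat \<Rightarrow> nat \<Rightarrow> nat \<Rightarrow> real" where
  "pp_mttkrp_col N s X Ap dA n k y =
     mttkrp_col N s X Ap n k y +
     (\<Sum>i\<in>{1..N} - {n}. \<Sum>x=1..s i. pp_operator N s X Ap i n x y k * dA i x k)"

definition tensor_ratio ::
  "nat \<Rightarrow> (nat \<Rightarrow> nat) \<Rightarrow> tensor \<Rightarrow> (nat \<Rightarrow> nat \<Rightarrow> real) \<Rightarrow> real" where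
  "tensor_ratio N s T x =
     L2_set (\<lambda>y. tensor_contract s T {2..N} x (\<lambda>l\<in>{1}. y)) {1..s 1}
     / (\<Prod>i=2..N. L2_set (x i) {1..s i})"

text \<open>
  Mode 1 is the uncontracted one, whatever the mode in which the MTTKRP is taken. The case
  distinction is needed since in \<^typ>\<open>ereal\<close> the quotient \<open>0 / 0\<close> is \<open>0\<close>.
\<close>

definition tensor_cond :: "nat \<Rightarrow> (nat \<Rightarrow> nat) \<Rightarrow> tensor \<Rightarrow> ereal" where
  "tensor_cond N s T =
     (let D = {x. \<forall>i\<in>{2..N}. nonzero_vec (s i) (x i)};
          hi = (SUP x\<in>D. ereal (tensor_ratio N s T x));
          lo = (INF x\<in>D. ereal (tensor_ratio N s T x))
      in if lo = 0 then \<infinity> else hi / lo)"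

end

theory Submission
  imports Defs
begin

text \<open>
  If \<open>\<kappa>(X)\<close> is finite, fixing the vectors of all modes other than \<open>1\<close> and \<open>n\<close> turns the
  contraction into an injective \<open>s\<^sub>1 \<times> s\<^sub>n\<close> matrix; as \<open>s\<^sub>1 \<le> s\<^sub>n\<close>, it is square, and so its
  transpose has the same extreme singular values. Hence the two-sided bounds on the
  contractions that leave mode \<open>1\<close> free also hold when mode \<open>n\<close> is left free. Expanding
  \<open>a = a\<^sub>p + da\<close> multilinearly, the error consists of at most \<open>2\<^sup>N\<close> contractions with at least two
  factors \<open>da\<close>, each of norm at most \<open>2\<^sup>N \<epsilon>\<^sup>2 (sup f) \<Prod>\<parallel>a\<parallel>\<close>, while the exact column
  has norm at least \<open>(inf f) \<Prod>\<parallel>a\<parallel>\<close>.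
\<close>

section \<open>Linear systems and norm bounds for transposed matrices\<close>

text \<open>Gaussian elimination: an equation with a nonzero coefficient is solved for a pivot
  unknown, leaving one equation and one unknown fewer. In \<open>adjoint_lower_bound\<close> this
  yields the surjectivity of an injective matrix.\<close>

lemma underdetermined_system_nontrivial_solution:
  fixes c :: "'e \<Rightarrow> 'i \<Rightarrow> real"
  assumes "finite E" "finite I" "card E < card I"
  shows "\<exists>w. (\<exists>i\<in>I. w i \<noteq> 0) \<and> (\<forall>e\<in>E. (\<Sum>i\<in>I. c e i * w i) = 0)"
  using assms
proof (induction E arbitrary: I c rule: finite_induct)
  case empty
  then show ?case by (intro exI[of _ "\<lambda>_. 1"]) (auto simp: card_gt_0_iff)
next
  case (insert e E)
  show ?case
  proof (cases "\<forall>i\<in>I. c e i = 0")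
    case True
    have "card E < card I" using insert by simp
    from insert.IH[OF \<open>finite I\<close> this, of c]
    obtain w where "\<exists>i\<in>I. w i \<noteq> 0" "\<forall>e'\<in>E. (\<Sum>i\<in>I. c e' i * w i) = 0" by blast
    then show ?thesis using True by (intro exI[of _ w]) simp
  next
    case False
    then obtain p where p: "p \<in> I" "c e p \<noteq> 0" by blast
    define J where "J = I - {p}"
    have J: "finite J" "card E < card J" "I = insert p J" "p \<notin> J"
      using insert p by (auto simp: J_def)
    \<comment> \<open>Subtracting the multiple \<open>c e' p / c e p\<close> of equation
      \<open>e\<close> removes the unknown \<open>p\<close> from equation \<open>e'\<close>.\<close>
    obtain w where w: "\<exists>i\<in>J. w i \<noteq> 0"
      "\<And>e'. e' \<in> E \<Longrightarrow> (\<Sum>i\<in>J. (c e' i - c e' p / c e p * c e i) * w i) = 0"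
      using insert.IH[OF J(1,2), of "\<lambda>e' i. c e' i - c e' p / c e p * c e i"] by blast
    define S where "S = (\<Sum>i\<in>J. c e i * w i)"
    \<comment> \<open>The value at the pivot is the one that equation \<open>e\<close>
      forces.\<close>
    define w' where "w' = w(p := - S / c e p)"
    have split: "(\<Sum>i\<in>I. c e' i * w' i) = c e' p * (- S / c e p) + (\<Sum>i\<in>J. c e' i * w i)" for e'
    proof -
      have "(\<Sum>i\<in>J. c e' i * w' i) = (\<Sum>i\<in>J. c e' i * w i)"
        using J(4) by (intro sum.cong) (auto simp: w'_def)
      then show ?thesis using J by (simp add: w'_def)
    qed
    have "(\<Sum>i\<in>I. c e i * w' i) = 0"
      unfolding split S_def[symmetric] using p by simp
    moreover have "(\<Sum>i\<in>I. c e' i * w' i) = 0" if "e' \<in> E" for e'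
    proof -
      have "0 = (\<Sum>i\<in>J. c e' i * w i) - c e' p / c e p * S"
        using w(2)[OF that] by (simp add: S_def algebra_simps sum_subtractf sum_distrib_left)
      then show ?thesis unfolding split by simp
    qed
    moreover have "\<exists>i\<in>I. w' i \<noteq> 0" using w(1) J by (auto simp: w'_def)
    ultimately show ?thesis by (intro exI[of _ w']) auto
  qed
qed

lemma L2_set_power2_eq: "(L2_set f A)\<^sup>2 = (\<Sum>i\<in>A. f i * f i)"
  by (simp add: L2_set_def sum_nonneg power2_eq_square)

lemma sum_mult_le_L2_set: "(\<Sum>i\<in>A. f i * g i) \<le> L2_set f A * L2_set g A"
proof -
  have "(\<Sum>i\<in>A. f i * g i) \<le> (\<Sum>i\<in>A. \<bar>f i\<bar> * \<bar>g i\<bar>)"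
    by (intro sum_mono) (metis abs_ge_self abs_mult)
  also have "\<dots> \<le> L2_set f A * L2_set g A" by (rule L2_set_mult_ineq)
  finally show ?thesis .
qed

lemma nonzero_vec_iff_L2_set_pos: "nonzero_vec d v \<longleftrightarrow> 0 < L2_set v {1..d}"
proof -
  have "nonzero_vec d v \<longleftrightarrow> L2_set v {1..d} \<noteq> 0"
    by (auto simp: nonzero_vec_def L2_set_eq_0_iff)
  then show ?thesis using L2_set_nonneg[of v "{1..d}"] by linarith
qed

text \<open>Let \<open>z\<close> be the transpose applied to \<open>u\<close>. Its squared norm is
  the inner product of \<open>u\<close> with the image of \<open>z\<close> under \<open>B\<close>;
  Cauchy-Schwarz and the assumed bound leave one factor, the norm of \<open>z\<close>, to
  cancel.\<close>

lemma adjoint_upper_bound: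
  fixes B :: "'a \<Rightarrow> 'b \<Rightarrow> real"
  assumes "0 \<le> c" and le: "\<And>w. L2_set (\<lambda>x. \<Sum>y\<in>F. B x y * w y) E \<le> c * L2_set w F"
  shows "L2_set (\<lambda>y. \<Sum>x\<in>E. B x y * u x) F \<le> c * L2_set u E"
proof -
  define z where "z = (\<lambda>y. \<Sum>x\<in>E. B x y * u x)"
  have "(L2_set z F)\<^sup>2 = (\<Sum>y\<in>F. \<Sum>x\<in>E. B x y * u x * z y)"
    unfolding L2_set_power2_eq by (subst (1) z_def) (simp add: sum_distrib_right)
  also have "\<dots> = (\<Sum>x\<in>E. u x * (\<Sum>y\<in>F. B x y * z y))"
    by (subst sum.swap) (simp add: sum_distrib_left mult_ac)
  also have "\<dots> \<le> L2_set u E * L2_set (\<lambda>x. \<Sum>y\<in>F. B x y * z y) E"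
    by (rule sum_mult_le_L2_set)
  also have "\<dots> \<le> L2_set u E * (c * L2_set z F)"
    by (intro mult_left_mono le) auto
  finally have "L2_set z F * L2_set z F \<le> (c * L2_set u E) * L2_set z F"
    by (simp add: power2_eq_square mult_ac)
  moreover have "0 \<le> c * L2_set u E" using \<open>0 \<le> c\<close> by simp
  ultimately have "L2_set z F \<le> c * L2_set u E"
    using L2_set_nonneg[of z F] by (metis mult_right_le_imp_le order_le_less)
  then show ?thesis by (simp add: z_def)
qed

text \<open>
  The lower bound makes \<open>B\<close> injective, hence surjective as there are at least as many columns as
  rows; testing \<open>u\<close> against a preimage of \<open>u\<close> transfers the bound to the transpose.
\<close>

lemma adjoint_lower_bound:
  fixes B :: "'a \<Rightarrow> 'b \<Rightarrow> real"
  assumes fin: "finite E" "finite F" and card: "card E \<le> card F" and "0 < c"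
    and ge: "\<And>w. c * L2_set w F \<le> L2_set (\<lambda>x. \<Sum>y\<in>F. B x y * w y) E"
  shows "c * L2_set u E \<le> L2_set (\<lambda>y. \<Sum>x\<in>E. B x y * u x) F"
proof -
  \<comment> \<open>The unknowns are a coefficient of \<open>u\<close> (\<open>None\<close>) and one
    for each column of \<open>B\<close> (\<open>Some y\<close>). They outnumber the rows, so these
    vectors satisfy a nontrivial linear relation.\<close>
  define I where "I = insert None (Some ` F)"
  have "finite I" "card E < card I"
    using fin card by (auto simp: I_def card_image)
  from underdetermined_system_nontrivial_solution[OF fin(1) this,
      of "\<lambda>x i. case i of None \<Rightarrow> u x | Some y \<Rightarrow> B x y"]
  obtain w where w: "\<exists>i\<in>I. w i \<noteq> 0"
    "\<And>x. x \<in> E \<Longrightarrow> (\<Sum>i\<in>I. (case i of None \<Rightarrow> u x | Some y \<Rightarrow> B x y) * w i) = 0"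
    by blast
  have eq: "u x * w None + (\<Sum>y\<in>F. B x y * w (Some y)) = 0" if "x \<in> E" for x
    using w(2)[OF that] fin by (simp add: I_def sum.reindex)
  \<comment> \<open>Otherwise the relation involves the columns of \<open>B\<close> alone, against
    the injectivity that \<open>ge\<close> gives.\<close>
  have t: "w None \<noteq> 0"
  proof
    assume 0: "w None = 0"
    then have "c * L2_set (\<lambda>y. w (Some y)) F \<le> 0"
      using ge[of "\<lambda>y. w (Some y)"] L2_set_0'[of E "\<lambda>x. \<Sum>y\<in>F. B x y * w (Some y)"] eq by auto
    then have "L2_set (\<lambda>y. w (Some y)) F = 0"
      using \<open>0 < c\<close> L2_set_nonneg[of "\<lambda>y. w (Some y)" F]
      by (metis antisym mult_le_cancel_left_pos mult_zero_right)
    then show False using w(1) 0 fin by (auto simp: I_def L2_set_eq_0_iff)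
  qed
  define v where "v = (\<lambda>y. - w (Some y) / w None)"
  have v: "(\<Sum>y\<in>F. B x y * v y) = u x" if "x \<in> E" for x
  proof -
    have "(\<Sum>y\<in>F. B x y * v y) = - (\<Sum>y\<in>F. B x y * w (Some y)) / w None"
      by (simp add: v_def sum_divide_distrib sum_negf)
    also have "- (\<Sum>y\<in>F. B x y * w (Some y)) = u x * w None"
      using eq[OF that] by linarith
    finally show ?thesis using t by simp
  qed
  define z where "z = (\<lambda>y. \<Sum>x\<in>E. B x y * u x)"
  have "(L2_set u E)\<^sup>2 = (\<Sum>x\<in>E. u x * (\<Sum>y\<in>F. B x y * v y))"
    unfolding L2_set_power2_eq using v by simp
  also have "\<dots> = (\<Sum>y\<in>F. z y * v y)"
    unfolding z_def sum_distrib_left sum_distrib_right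
    by (subst sum.swap) (simp add: mult_ac)
  also have "\<dots> \<le> L2_set z F * L2_set v F"
    by (rule sum_mult_le_L2_set)
  finally have "c * (L2_set u E)\<^sup>2 \<le> c * (L2_set z F * L2_set v F)"
    using \<open>0 < c\<close> by simp
  also have "\<dots> = L2_set z F * (c * L2_set v F)" by simp
  \<comment> \<open>As \<open>B\<close> maps \<open>v\<close> to \<open>u\<close>, \<open>ge\<close>
    bounds \<open>c\<close> times the norm of \<open>v\<close> by the norm of
    \<open>u\<close>.\<close>
  also have "\<dots> \<le> L2_set z F * L2_set u E"
    using ge[of v] v by (intro mult_left_mono) (simp_all cong: L2_set_cong_simp)
  finally have "(c * L2_set u E) * L2_set u E \<le> L2_set z F * L2_set u E"
    by (simp add: power2_eq_square mult_ac)
  then have "c * L2_set u E \<le> L2_set z F"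
    using L2_set_nonneg[of u E] L2_set_nonneg[of z F]
    by (metis mult_right_le_imp_le order_le_less mult_zero_right)
  then show ?thesis by (simp add: z_def)
qed

section \<open>Multilinearity of tensor contraction\<close>

lemma tensor_contract_cong:
  assumes "\<And>j x. j \<in> J \<Longrightarrow> x \<in> {1..s j} \<Longrightarrow> v j x = w j x"
  shows "tensor_contract s X J v y = tensor_contract s X J w y"
  unfolding tensor_contract_def using assms
  by (intro sum.cong refl arg_cong2[where f = "(*)"] prod.cong) (auto dest: PiE_mem)

text \<open>Serves for vector families outside the domain of the supremum in
  \<open>tensor_cond\<close>, where the upper bound has to hold as well.\<close>

lemma tensor_contract_zero:
  assumes "finite J" "i \<in> J" "\<not> nonzero_vec (s i) (v i)"
  shows "tensor_contract s X J v y = 0"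
  unfolding tensor_contract_def
proof (intro sum.neutral ballI)
  fix h assume "h \<in> (\<Pi>\<^sub>E j\<in>J. {1..s j})"
  then have "v i (h i) = 0" using assms by (auto simp: nonzero_vec_def dest: PiE_mem)
  then show "X (override_on y h J) * (\<Prod>j\<in>J. v j (h j)) = 0"
    using assms by (auto intro: prod_zero)
qed

text \<open>The multi-indices on \<open>J\<close> are grouped by their entry at mode
  \<open>i\<close>. With the other vectors fixed, a contraction thus becomes a matrix-vector
  product; the same step links the pairwise operators to the first-order terms of the
  expansion.\<close>

lemma tensor_contract_split:
  assumes "finite J" "i \<in> J"
  shows "tensor_contract s X J v y =
    (\<Sum>x=1..s i. tensor_contract s X (J - {i}) v (y(i := x)) * v i x)"
proof -
  define K where "K = J - {i}"
  have K: "J = insert i K" "i \<notin> K" "finite K" using assms by (auto simp: K_def)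
  have upd: "X (override_on y (h(i := x)) J) * (\<Prod>j\<in>J. v j ((h(i := x)) j))
      = X (override_on (y(i := x)) h K) * (\<Prod>j\<in>K. v j (h j)) * v i x" for x h
  proof -
    have "override_on y (h(i := x)) J = override_on (y(i := x)) h K"
      using K by (auto simp: override_on_def)
    moreover have "(\<Prod>j\<in>K. v j ((h(i := x)) j)) = (\<Prod>j\<in>K. v j (h j))"
      using K by (intro prod.cong) auto
    ultimately show ?thesis using K by simp
  qed
  have "tensor_contract s X J v y =
      (\<Sum>(x, h)\<in>{1..s i} \<times> (\<Pi>\<^sub>E j\<in>K. {1..s j}).
        X (override_on y (h(i := x)) J) * (\<Prod>j\<in>J. v j ((h(i := x)) j)))"
    unfolding tensor_contract_def
    by (subst (1) K(1), subst PiE_insert_eq, subst sum.reindex[OF inj_combinator[OF K(2)]])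
       (simp add: case_prod_unfold)
  also have "\<dots> = (\<Sum>x=1..s i. tensor_contract s X K v (y(i := x)) * v i x)"
    unfolding upd sum.cartesian_product[symmetric] tensor_contract_def sum_distrib_right ..
  finally show ?thesis by (simp add: K_def)
qed

text \<open>Distributivity of the product over \<open>J\<close>: each subset \<open>S\<close>
  records the modes that take the summand \<open>d\<close>.\<close>

lemma tensor_contract_add:
  assumes "finite J"
  shows "tensor_contract s X J (\<lambda>j x. d j x + p j x) y =
    (\<Sum>S\<in>Pow J. tensor_contract s X J (\<lambda>j x. if j \<in> S then d j x else p j x) y)"
proof -
  have "(\<Prod>j\<in>J. d j (h j) + p j (h j)) =
      (\<Sum>S\<in>Pow J. \<Prod>j\<in>J. if j \<in> S then d j (h j) else p j (h j))" for h
  proof -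
    have "(\<Prod>j\<in>S. d j (h j)) * (\<Prod>j\<in>J - S. p j (h j))
        = (\<Prod>j\<in>J. if j \<in> S then d j (h j) else p j (h j))" if "S \<subseteq> J" for S
    proof -
      have "(\<Prod>j\<in>J. if j \<in> S then d j (h j) else p j (h j))
          = (\<Prod>j\<in>J - S. if j \<in> S then d j (h j) else p j (h j))
            * (\<Prod>j\<in>S. if j \<in> S then d j (h j) else p j (h j))"
        using that assms by (rule prod.subset_diff)
      then show ?thesis by (simp add: mult.commute)
    qed
    then show ?thesis using assms by (simp add: prod_add)
  qed
  then show ?thesis
    unfolding tensor_contract_def by (simp add: sum_distrib_left) (rule sum.swap)
qed

section \<open>Transfer of bounds between free modes\<close>

text \<open>For \<open>I = {1..N}\<close>, this is the numerator of \<open>tensor_ratio\<close> when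
  \<open>n = 1\<close>, and the norm of an MTTKRP column when \<open>v\<close> consists of factor
  matrix columns.\<close>

definition mode_norm ::
  "(nat \<Rightarrow> nat) \<Rightarrow> tensor \<Rightarrow> nat set \<Rightarrow> nat \<Rightarrow> (nat \<Rightarrow> nat \<Rightarrow> real) \<Rightarrow> real" where
  "mode_norm s X I n v =
     L2_set (\<lambda>y. tensor_contract s X (I - {n}) v (\<lambda>l\<in>{n}. y)) {1..s n}"

text \<open>With the vectors of all modes but \<open>m\<close> and \<open>n\<close> fixed, the two
  contractions are a matrix \<open>B\<close> and its transpose applied to the remaining vector. The
  adjoint lemmas then apply with the constants \<open>lo * P\<close> and \<open>hi * P\<close>;
  \<open>s m \<le> s n\<close> enters in the lower bound.\<close>

lemma mode_norm_change_mode: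
  assumes fin: "finite I" and I: "m \<in> I" "n \<in> I" and le: "s m \<le> s n"
    and "0 < lo" "0 \<le> hi"
    and lower: "\<And>v. \<forall>i\<in>I - {m}. nonzero_vec (s i) (v i) \<Longrightarrow>
      lo * (\<Prod>i\<in>I - {m}. L2_set (v i) {1..s i}) \<le> mode_norm s X I m v"
    and upper: "\<And>v. mode_norm s X I m v \<le> hi * (\<Prod>i\<in>I - {m}. L2_set (v i) {1..s i})"
  shows "\<forall>i\<in>I - {n}. nonzero_vec (s i) (v i) \<Longrightarrow>
      lo * (\<Prod>i\<in>I - {n}. L2_set (v i) {1..s i}) \<le> mode_norm s X I n v"
    and "mode_norm s X I n v \<le> hi * (\<Prod>i\<in>I - {n}. L2_set (v i) {1..s i})"
proof -
  define K where "K = I - {m, n}"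
  define B where "B = (\<lambda>x y. tensor_contract s X K v ((\<lambda>l\<in>{n}. y)(m := x)))"
  define P where "P = (\<Prod>i\<in>K. L2_set (v i) {1..s i})"
  have P: "0 \<le> P" by (simp add: P_def prod_nonneg)
  \<comment> \<open>\<open>B\<close> is read in both directions: with mode \<open>n\<close> free its
    transpose is applied to \<open>v m\<close>; with mode \<open>m\<close> free it is applied to an
    arbitrary \<open>w\<close> put in place of \<open>v n\<close>.\<close>
  have norm_n: "mode_norm s X I n v = L2_set (\<lambda>y. \<Sum>x\<in>{1..s m}. B x y * v m x) {1..s n}"
    and prod_n: "(\<Prod>i\<in>I - {n}. L2_set (v i) {1..s i}) = L2_set (v m) {1..s m} * P"
    and norm_m: "\<And>w. mode_norm s X I m (v(n := w))
      = L2_set (\<lambda>x. \<Sum>y\<in>{1..s n}. B x y * w y) {1..s m}"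
    and prod_m: "\<And>w. (\<Prod>i\<in>I - {m}. L2_set ((v(n := w)) i) {1..s i}) = L2_set w {1..s n} * P"
    if "m \<noteq> n"
  proof -
    have K: "I - {n} = insert m K" "I - {m} = insert n K" "m \<notin> K" "n \<notin> K" "finite K"
      using that I fin by (auto simp: K_def)
    show "mode_norm s X I n v = L2_set (\<lambda>y. \<Sum>x\<in>{1..s m}. B x y * v m x) {1..s n}"
      unfolding mode_norm_def B_def K(1) using K
      by (subst tensor_contract_split[of _ m]) simp_all
    show "(\<Prod>i\<in>I - {n}. L2_set (v i) {1..s i}) = L2_set (v m) {1..s m} * P"
      using K by (simp add: P_def)
    show "mode_norm s X I m (v(n := w)) = L2_set (\<lambda>x. \<Sum>y\<in>{1..s n}. B x y * w y) {1..s m}" for w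
    proof -
      have "tensor_contract s X (insert n K) (v(n := w)) (\<lambda>l\<in>{m}. x) =
          (\<Sum>y\<in>{1..s n}. B x y * w y)" for x
      proof -
        have "tensor_contract s X K (v(n := w)) ((\<lambda>l\<in>{m}. x)(n := y)) = B x y" for y
        proof -
          have "(\<lambda>l\<in>{m}. x)(n := y) = (\<lambda>l\<in>{n}. y)(m := x)" using that by (auto simp: restrict_def)
          then show ?thesis unfolding B_def using K by (simp, intro tensor_contract_cong) auto
        qed
        then show ?thesis using K by (subst tensor_contract_split[of _ n]) simp_all
      qed
      then show ?thesis unfolding mode_norm_def K(2) by simp
    qed
    show "(\<Prod>i\<in>I - {m}. L2_set ((v(n := w)) i) {1..s i}) = L2_set w {1..s n} * P" for w
    proof -
      have "(\<Prod>i\<in>K. L2_set ((v(n := w)) i) {1..s i}) = P"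
        unfolding P_def using K by (intro prod.cong) auto
      then show ?thesis using K by simp
    qed
  qed
  show "mode_norm s X I n v \<le> hi * (\<Prod>i\<in>I - {n}. L2_set (v i) {1..s i})"
  proof (cases "m = n")
    case False
    have "L2_set (\<lambda>x. \<Sum>y\<in>{1..s n}. B x y * w y) {1..s m} \<le> hi * P * L2_set w {1..s n}" for w
      using upper[of "v(n := w)"] norm_m[OF False, of w] prod_m[OF False, of w]
      by (simp add: mult_ac)
    from adjoint_upper_bound[OF _ this, of "v m"] show ?thesis
      using P \<open>0 \<le> hi\<close> norm_n[OF False] prod_n[OF False] by (simp add: mult_ac)
  qed (use upper in simp)
  show "lo * (\<Prod>i\<in>I - {n}. L2_set (v i) {1..s i}) \<le> mode_norm s X I n v"
    if nz: "\<forall>i\<in>I - {n}. nonzero_vec (s i) (v i)"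
  proof (cases "m = n")
    case False
    have "0 < P"
      unfolding P_def using nz by (intro prod_pos) (auto simp: K_def nonzero_vec_iff_L2_set_pos)
    \<comment> \<open>\<open>adjoint_lower_bound\<close> asks for every \<open>w\<close>, while
      \<open>lower\<close> covers nonzero vectors only; for a vanishing \<open>w\<close> the left
      side is zero.\<close>
    have "lo * P * L2_set w {1..s n} \<le> L2_set (\<lambda>x. \<Sum>y\<in>{1..s n}. B x y * w y) {1..s m}" for w
    proof (cases "nonzero_vec (s n) w")
      case True
      then have "\<forall>i\<in>I - {m}. nonzero_vec (s i) ((v(n := w)) i)" using nz by auto
      from lower[OF this] show ?thesis
        unfolding norm_m[OF False] prod_m[OF False] by (simp add: mult_ac)
    next
      case False
      then have "L2_set w {1..s n} = 0" by (auto simp: nonzero_vec_def intro!: L2_set_0')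
      then show ?thesis by simp
    qed
    from adjoint_lower_bound[OF _ _ _ _ this, of "v m"] show ?thesis
      using \<open>0 < P\<close> \<open>0 < lo\<close> le norm_n[OF False] prod_n[OF False] by (simp add: mult_ac)
  qed (use lower nz in simp)
qed

section \<open>Two-sided bounds from a finite condition number\<close>

text \<open>\<open>lo\<close> and \<open>hi\<close> are the infimum and supremum of
  \<open>tensor_ratio\<close>. Finiteness of their quotient makes \<open>lo\<close> positive and
  \<open>hi\<close> real; clearing denominators gives the bounds.\<close>

lemma tensor_cond_finite_bounds:
  assumes dim: "\<forall>l\<in>{1..N}. 1 \<le> s l" and fin: "tensor_cond N s X \<noteq> \<infinity>"
  obtains lo hi where "0 < lo" "0 \<le> hi" "tensor_cond N s X = ereal (hi / lo)"
    "\<And>v. \<forall>i\<in>{1..N} - {1}. nonzero_vec (s i) (v i) \<Longrightarrow>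
      lo * (\<Prod>i\<in>{1..N} - {1}. L2_set (v i) {1..s i}) \<le> mode_norm s X {1..N} 1 v"
    "\<And>v. mode_norm s X {1..N} 1 v \<le> hi * (\<Prod>i\<in>{1..N} - {1}. L2_set (v i) {1..s i})"
proof -
  define D where "D = {x. \<forall>i\<in>{2..N}. nonzero_vec (s i) (x i)}"
  define Hi where "Hi = (SUP x\<in>D. ereal (tensor_ratio N s X x))"
  define Lo where "Lo = (INF x\<in>D. ereal (tensor_ratio N s X x))"
  have idx: "{1..N} - {1} = {2..N}" by auto
  have ratio: "tensor_ratio N s X v
      = mode_norm s X {1..N} 1 v / (\<Prod>i\<in>{1..N} - {1}. L2_set (v i) {1..s i})" for v
    unfolding tensor_ratio_def mode_norm_def idx ..
  have cond: "tensor_cond N s X = (if Lo = 0 then \<infinity> else Hi / Lo)"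
    by (simp add: tensor_cond_def Let_def Hi_def Lo_def D_def)
  \<comment> \<open>The all-ones vectors show that \<open>D\<close> is nonempty, so that the infimum
    is below infinity and the supremum is nonnegative.\<close>
  have one: "(\<lambda>_ _. 1) \<in> D" using dim by (force simp: D_def nonzero_vec_def)
  have nonneg: "0 \<le> tensor_ratio N s X v" for v
    by (simp add: ratio mode_norm_def prod_nonneg)
  have "0 \<le> Lo" unfolding Lo_def using nonneg by (auto intro: INF_greatest)
  moreover have "Lo \<noteq> 0" using fin cond by auto
  moreover have "Lo \<le> ereal (tensor_ratio N s X (\<lambda>_ _. 1))"
    unfolding Lo_def using one by (rule INF_lower)
  ultimately obtain lo where lo: "Lo = ereal lo" "0 < lo"
    by (cases Lo) auto
  have "ereal (tensor_ratio N s X (\<lambda>_ _. 1)) \<le> Hi"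
    unfolding Hi_def using one by (rule SUP_upper)
  then have "0 \<le> Hi" using nonneg[of "\<lambda>_ _. 1"] by (meson ereal_less_eq(5) order_trans)
  \<comment> \<open>An infinite supremum divided by the positive real \<open>lo\<close> would be
    infinite.\<close>
  moreover have "Hi \<noteq> \<infinity>" using fin cond lo by auto
  ultimately obtain hi where hi: "Hi = ereal hi" "0 \<le> hi"
    by (cases Hi) auto
  have pos: "0 < (\<Prod>i\<in>{1..N} - {1}. L2_set (v i) {1..s i})"
    if "\<forall>i\<in>{1..N} - {1}. nonzero_vec (s i) (v i)" for v
    using that by (intro prod_pos) (auto simp: nonzero_vec_iff_L2_set_pos)
  have mem: "v \<in> D" if "\<forall>i\<in>{1..N} - {1}. nonzero_vec (s i) (v i)" for v
    using that by (simp add: D_def idx)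
  show thesis
  proof
    show "0 < lo" "0 \<le> hi" by fact+
    show "tensor_cond N s X = ereal (hi / lo)" using cond lo hi by simp
    show "lo * (\<Prod>i\<in>{1..N} - {1}. L2_set (v i) {1..s i}) \<le> mode_norm s X {1..N} 1 v"
      if nz: "\<forall>i\<in>{1..N} - {1}. nonzero_vec (s i) (v i)" for v
    proof -
      have "Lo \<le> ereal (tensor_ratio N s X v)"
        unfolding Lo_def using mem[OF nz] by (rule INF_lower)
      then show ?thesis using pos[OF nz] by (simp add: lo ratio pos_le_divide_eq)
    qed
    show "mode_norm s X {1..N} 1 v \<le> hi * (\<Prod>i\<in>{1..N} - {1}. L2_set (v i) {1..s i})" for v
    proof (cases "\<forall>i\<in>{1..N} - {1}. nonzero_vec (s i) (v i)")
      case True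
      have "ereal (tensor_ratio N s X v) \<le> Hi"
        unfolding Hi_def using mem[OF True] by (rule SUP_upper)
      then show ?thesis using pos[OF True] by (simp add: hi ratio pos_divide_le_eq)
    next
      case False
      then obtain i where "i \<in> {1..N} - {1}" "\<not> nonzero_vec (s i) (v i)" by blast
      then have "mode_norm s X {1..N} 1 v = 0"
        unfolding mode_norm_def
        by (intro L2_set_0' ballI tensor_contract_zero) auto
      then show ?thesis using hi by (simp add: prod_nonneg)
    qed
  qed
qed

section \<open>Expansion of the error and size of its terms\<close>

lemma L2_set_sum_le: "L2_set (\<lambda>x. \<Sum>i\<in>I. f i x) A \<le> (\<Sum>i\<in>I. L2_set (f i) A)"
proof (induction I rule: infinite_finite_induct)
  case (insert i I)
  then show ?case
    using L2_set_triangle_ineq[of "f i" "\<lambda>x. \<Sum>i\<in>I. f i x" A] by simp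
qed (simp_all add: L2_set_0')

text \<open>
  In the expansion of the MTTKRP over the set \<open>S\<close> of perturbed modes, pairwise perturbation keeps
  exactly the terms with at most one perturbed mode.
\<close>

lemma pp_mttkrp_col_eq_sum:
  assumes "n \<in> {1..N}"
  shows "pp_mttkrp_col N s X Ap dA n k y =
    (\<Sum>S\<in>{S \<in> Pow ({1..N} - {n}). card S < 2}. tensor_contract s X ({1..N} - {n})
      (\<lambda>j x. if j \<in> S then dA j x k else Ap j x k) (\<lambda>l\<in>{n}. y))"
proof -
  define J where "J = {1..N} - {n}"
  define G where "G = (\<lambda>S. tensor_contract s X J
      (\<lambda>j x. if j \<in> S then dA j x k else Ap j x k) (\<lambda>l\<in>{n}. y))"
  have fin: "finite J" by (simp add: J_def)
  have single: "(\<Sum>x=1..s i. pp_operator N s X Ap i n x y k * dA i x k) = G {i}" if i: "i \<in> J" for i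
  proof -
    have "pp_operator N s X Ap i n x y k = tensor_contract s X (J - {i})
        (\<lambda>j x. if j \<in> {i} then dA j x k else Ap j x k) ((\<lambda>l\<in>{n}. y)(i := x))" for x
    proof -
      have "{1..N} - {i, n} = J - {i}" by (auto simp: J_def)
      moreover have "(\<lambda>l\<in>{i, n}. if l = i then x else y) = (\<lambda>l\<in>{n}. y)(i := x)"
        using i by (auto simp: restrict_def J_def)
      ultimately show ?thesis
        unfolding pp_operator_def by (simp, intro tensor_contract_cong) auto
    qed
    then show ?thesis
      unfolding G_def using fin i by (subst tensor_contract_split[of _ i]) simp_all
  qed
  have "{S \<in> Pow J. card S < 2} = insert {} ((\<lambda>i. {i}) ` J)"
  proof (intro equalityI subsetI)
    fix S assume S: "S \<in> {S \<in> Pow J. card S < 2}"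
    then have "finite S" using fin finite_subset by blast
    moreover have "card S = 0 \<or> card S = 1" using S by auto
    ultimately show "S \<in> insert {} ((\<lambda>i. {i}) ` J)" using S by (auto simp: card_1_singleton_iff)
  qed auto
  then have "(\<Sum>S\<in>{S \<in> Pow J. card S < 2}. G S) = G {} + (\<Sum>S\<in>(\<lambda>i. {i}) ` J. G S)"
    using fin by (simp add: image_iff)
  also have "(\<Sum>S\<in>(\<lambda>i. {i}) ` J. G S) = (\<Sum>i\<in>J. G {i})"
    by (subst sum.reindex) auto
  also have "G {} = mttkrp_col N s X Ap n k y" by (simp add: G_def mttkrp_col_def J_def)
  also have "\<dots> + (\<Sum>i\<in>J. G {i}) = pp_mttkrp_col N s X Ap dA n k y"
    unfolding pp_mttkrp_col_def using single by (simp add: J_def)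
  finally show ?thesis by (simp add: G_def J_def)
qed

text \<open>\<open>\<alpha>\<close>, \<open>\<delta>\<close> and \<open>\<pi>\<close> stand for the
  column norms of \<open>A\<close>, \<open>dA\<close> and \<open>Ap\<close>. Every factor is allowed
  a 2, whence \<open>2 ^ card J\<close>; the perturbed ones contribute
  \<open>\<epsilon> ^ card S\<close>, at most \<open>\<epsilon>\<^sup>2\<close> since
  \<open>2 \<le> card S\<close> and \<open>\<epsilon> \<le> 1\<close>.\<close>

lemma perturbation_term_norm_le:
  fixes \<alpha> \<delta> \<pi> :: "'i \<Rightarrow> real"
  assumes "finite J" "S \<subseteq> J" "2 \<le> card S" "0 \<le> \<epsilon>" "\<epsilon> \<le> 1"
    and \<delta>: "\<And>j. j \<in> J \<Longrightarrow> 0 \<le> \<delta> j \<and> \<delta> j \<le> \<epsilon> * \<alpha> j"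
    and \<pi>: "\<And>j. j \<in> J \<Longrightarrow> 0 \<le> \<pi> j \<and> \<pi> j \<le> 2 * \<alpha> j"
  shows "(\<Prod>j\<in>J. if j \<in> S then \<delta> j else \<pi> j) \<le> 2 ^ card J * \<epsilon>\<^sup>2 * (\<Prod>j\<in>J. \<alpha> j)"
proof -
  have \<alpha>: "0 \<le> \<alpha> j" if "j \<in> J" for j using \<pi>[OF that] by linarith
  have "(\<Prod>j\<in>J. if j \<in> S then \<delta> j else \<pi> j) \<le> (\<Prod>j\<in>J. 2 * ((if j \<in> S then \<epsilon> else 1) * \<alpha> j))"
  proof (rule prod_mono)
    fix j assume j: "j \<in> J"
    have "0 \<le> \<epsilon> * \<alpha> j" using \<alpha>[OF j] \<open>0 \<le> \<epsilon>\<close> by simp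
    then show "0 \<le> (if j \<in> S then \<delta> j else \<pi> j) \<and>
        (if j \<in> S then \<delta> j else \<pi> j) \<le> 2 * ((if j \<in> S then \<epsilon> else 1) * \<alpha> j)"
      using \<delta>[OF j] \<pi>[OF j] by auto
  qed
  also have "\<dots> = 2 ^ card J * ((\<Prod>j\<in>J. if j \<in> S then \<epsilon> else 1) * (\<Prod>j\<in>J. \<alpha> j))"
    by (simp add: prod.distrib)
  also have "(\<Prod>j\<in>J. if j \<in> S then \<epsilon> else 1) = \<epsilon> ^ card S"
  proof -
    have "J \<inter> S = S" using assms by auto
    then show ?thesis using \<open>finite J\<close> by (simp flip: prod.inter_restrict)
  qed
  also have "2 ^ card J * (\<epsilon> ^ card S * (\<Prod>j\<in>J. \<alpha> j)) \<le> 2 ^ card J * (\<epsilon>\<^sup>2 * (\<Prod>j\<in>J. \<alpha> j))"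
    using assms \<alpha> by (intro mult_left_mono mult_right_mono power_decreasing prod_nonneg) auto
  finally show ?thesis by (simp add: mult_ac)
qed

section \<open>The column-wise error estimate with explicit constants\<close>

theorem theorem8p3:
  fixes N :: nat
  shows "\<exists>C>0. \<exists>\<epsilon>0>0.
    \<forall>(s :: nat \<Rightarrow> nat) (X :: tensor) (R :: nat)
     (A :: nat \<Rightarrow> nat \<Rightarrow> nat \<Rightarrow> real) (Ap :: nat \<Rightarrow> nat \<Rightarrow> nat \<Rightarrow> real)
     (dA :: nat \<Rightarrow> nat \<Rightarrow> nat \<Rightarrow> real) (\<epsilon> :: real) (n :: nat).
      (\<forall>l\<in>{1..N}. 1 \<le> s l) \<longrightarrow>
      (\<forall>l\<in>{1..N}. \<forall>x\<in>{1..s l}. \<forall>k\<in>{1..R}. A l x k = Ap l x k + dA l x k) \<longrightarrow>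
      0 \<le> \<epsilon> \<longrightarrow> \<epsilon> \<le> \<epsilon>0 \<longrightarrow>
      (\<forall>l\<in>{1..N}. \<forall>k\<in>{1..R}.
          nonzero_vec (s l) (\<lambda>x. A l x k) \<and>
          L2_set (\<lambda>x. dA l x k) {1..s l} / L2_set (\<lambda>x. A l x k) {1..s l} \<le> \<epsilon>) \<longrightarrow>
      n \<in> {1..N} \<longrightarrow>
      (\<forall>m\<in>{1..N}. s m \<le> s n) \<longrightarrow>
      (\<forall>k\<in>{1..R}. tensor_cond N s X \<noteq> \<infinity> \<longrightarrow>
          nonzero_vec (s n) (mttkrp_col N s X A n k) \<and>
          ereal (L2_set (\<lambda>y. pp_mttkrp_col N s X Ap dA n k y - mttkrp_col N s X A n k y) {1..s n}
                 / L2_set (mttkrp_col N s X A n k) {1..s n})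
            \<le> ereal (C * \<epsilon>\<^sup>2) * tensor_cond N s X)"
proof (rule exI[of _ "4 ^ N"], intro conjI, simp, rule exI[of _ 1], intro conjI allI impI ballI, simp)
  \<comment> \<open>\<open>4 ^ N\<close> is \<open>2 ^ N\<close> for the number of error terms times
    \<open>2 ^ N\<close> for the size of each. The threshold 1 suffices to bound columns of
    \<open>Ap\<close> by twice those of \<open>A\<close> and higher powers of
    \<open>\<epsilon>\<close> by \<open>\<epsilon>\<^sup>2\<close>.\<close>
  fix s :: "nat \<Rightarrow> nat" and X :: tensor and R :: nat
    and A Ap dA :: "nat \<Rightarrow> nat \<Rightarrow> nat \<Rightarrow> real" and \<epsilon> :: real and n k :: nat
  assume dim: "\<forall>l\<in>{1..N}. 1 \<le> s l"
    and A: "\<forall>l\<in>{1..N}. \<forall>x\<in>{1..s l}. \<forall>k\<in>{1..R}. A l x k = Ap l x k + dA l x k"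
    and \<epsilon>: "0 \<le> \<epsilon>" "\<epsilon> \<le> 1"
    and small: "\<forall>l\<in>{1..N}. \<forall>k\<in>{1..R}. nonzero_vec (s l) (\<lambda>x. A l x k) \<and>
      L2_set (\<lambda>x. dA l x k) {1..s l} / L2_set (\<lambda>x. A l x k) {1..s l} \<le> \<epsilon>"
    and n: "n \<in> {1..N}" and max: "\<forall>m\<in>{1..N}. s m \<le> s n"
    and k: "k \<in> {1..R}" and fin: "tensor_cond N s X \<noteq> \<infinity>"
  define J where "J = {1..N} - {n}"
  have J: "finite J" "card J \<le> N" using n by (auto simp: J_def)
  define a where "a = (\<lambda>j x. A j x k)"
  define v where "v = (\<lambda>S j x. if j \<in> S then dA j x k else Ap j x k)"
  define P where "P = (\<Prod>j\<in>J. L2_set (a j) {1..s j})"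
  have nz: "\<forall>j\<in>J. nonzero_vec (s j) (a j)" using small k by (simp add: J_def a_def)
  have P: "0 < P" unfolding P_def using nz by (intro prod_pos) (auto simp: nonzero_vec_iff_L2_set_pos)
  obtain lo hi where lohi: "0 < lo" "0 \<le> hi" and cond: "tensor_cond N s X = ereal (hi / lo)"
    and lower1: "\<And>v. \<forall>i\<in>{1..N} - {1}. nonzero_vec (s i) (v i) \<Longrightarrow>
      lo * (\<Prod>i\<in>{1..N} - {1}. L2_set (v i) {1..s i}) \<le> mode_norm s X {1..N} 1 v"
    and upper1: "\<And>v. mode_norm s X {1..N} 1 v \<le> hi * (\<Prod>i\<in>{1..N} - {1}. L2_set (v i) {1..s i})"
    using tensor_cond_finite_bounds[OF dim fin] by blast
  \<comment> \<open>Maximality of \<open>s n\<close> is applied to mode 1, the one that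
    \<open>tensor_cond\<close> leaves free.\<close>
  have modes: "1 \<in> {1..N}" "s 1 \<le> s n" using n max by auto
  have lower_n: "lo * (\<Prod>j\<in>J. L2_set (w j) {1..s j}) \<le> mode_norm s X {1..N} n w"
    if "\<forall>j\<in>J. nonzero_vec (s j) (w j)" for w
    unfolding J_def
    by (rule mode_norm_change_mode(1)[OF finite_atLeastAtMost modes(1) n modes(2) lohi],
        erule lower1, rule upper1, use that in \<open>simp add: J_def\<close>)
  \<comment> \<open>Stated for arbitrary \<open>w\<close>, because columns of \<open>dA\<close> or
    \<open>Ap\<close> may be zero.\<close>
  have upper_n: "mode_norm s X {1..N} n w \<le> hi * (\<Prod>j\<in>J. L2_set (w j) {1..s j})" for w
    unfolding J_def
    by (rule mode_norm_change_mode(2)[OF finite_atLeastAtMost modes(1) n modes(2) lohi],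
        erule lower1, rule upper1)
  have lower: "lo * P \<le> L2_set (mttkrp_col N s X A n k) {1..s n}"
    using lower_n[OF nz] by (simp add: P_def mode_norm_def mttkrp_col_def[abs_def] a_def J_def)
  have expand: "mttkrp_col N s X A n k y =
      (\<Sum>S\<in>Pow J. tensor_contract s X J (v S) (\<lambda>l\<in>{n}. y))" for y
  proof -
    have "mttkrp_col N s X A n k y
        = tensor_contract s X J (\<lambda>j x. dA j x k + Ap j x k) (\<lambda>l\<in>{n}. y)"
      unfolding mttkrp_col_def J_def using A k by (intro tensor_contract_cong) auto
    then show ?thesis using tensor_contract_add[OF J(1)] by (simp add: v_def)
  qed
  \<comment> \<open>Removing the terms with at most one perturbed mode leaves those of second and
    higher order.\<close>
  have error: "mttkrp_col N s X A n k y - pp_mttkrp_col N s X Ap dA n k y =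
      (\<Sum>S\<in>{S \<in> Pow J. 2 \<le> card S}. tensor_contract s X J (v S) (\<lambda>l\<in>{n}. y))" for y
  proof -
    have "Pow J = {S \<in> Pow J. card S < 2} \<union> {S \<in> Pow J. 2 \<le> card S}" by auto
    then have "mttkrp_col N s X A n k y =
        (\<Sum>S\<in>{S \<in> Pow J. card S < 2} \<union> {S \<in> Pow J. 2 \<le> card S}.
          tensor_contract s X J (v S) (\<lambda>l\<in>{n}. y))"
      unfolding expand by (rule sum.cong) simp
    also have "\<dots> = (\<Sum>S\<in>{S \<in> Pow J. card S < 2}. tensor_contract s X J (v S) (\<lambda>l\<in>{n}. y))
        + (\<Sum>S\<in>{S \<in> Pow J. 2 \<le> card S}. tensor_contract s X J (v S) (\<lambda>l\<in>{n}. y))"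
      using J by (intro sum.union_disjoint) auto
    finally show ?thesis using pp_mttkrp_col_eq_sum[OF n] by (simp add: v_def J_def)
  qed
  have dnorm: "L2_set (\<lambda>x. dA j x k) {1..s j} \<le> \<epsilon> * L2_set (a j) {1..s j}"
    and pnorm: "L2_set (\<lambda>x. Ap j x k) {1..s j} \<le> 2 * L2_set (a j) {1..s j}" if j: "j \<in> J" for j
  proof -
    have pos: "0 < L2_set (a j) {1..s j}" using nz j by (simp add: nonzero_vec_iff_L2_set_pos)
    moreover have "L2_set (\<lambda>x. dA j x k) {1..s j} / L2_set (a j) {1..s j} \<le> \<epsilon>"
      using small k j by (simp add: J_def a_def)
    ultimately show d: "L2_set (\<lambda>x. dA j x k) {1..s j} \<le> \<epsilon> * L2_set (a j) {1..s j}"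
      by (simp add: pos_divide_le_eq)
    \<comment> \<open>The old column is the current one minus the perturbation, so the triangle
      inequality and \<open>\<epsilon> \<le> 1\<close> give the factor 2.\<close>
    have "L2_set (\<lambda>x. Ap j x k) {1..s j} = L2_set (\<lambda>x. a j x + (- dA j x k)) {1..s j}"
      using A k j by (intro L2_set_cong) (auto simp: J_def a_def)
    also have "\<dots> \<le> L2_set (a j) {1..s j} + L2_set (\<lambda>x. - dA j x k) {1..s j}"
      by (rule L2_set_triangle_ineq)
    also have "L2_set (\<lambda>x. - dA j x k) {1..s j} = L2_set (\<lambda>x. dA j x k) {1..s j}"
      by (simp add: L2_set_def)
    also have "\<dots> \<le> L2_set (a j) {1..s j}"
      using d \<epsilon> pos mult_left_le_one_le[of "L2_set (a j) {1..s j}" \<epsilon>] by linarith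
    finally show "L2_set (\<lambda>x. Ap j x k) {1..s j} \<le> 2 * L2_set (a j) {1..s j}" by simp
  qed
  have upper: "L2_set (\<lambda>y. tensor_contract s X J (v S) (\<lambda>l\<in>{n}. y)) {1..s n}
      \<le> 2 ^ N * (hi * \<epsilon>\<^sup>2 * P)" if S: "S \<in> {S \<in> Pow J. 2 \<le> card S}" for S
  proof -
    have "(\<Prod>j\<in>J. L2_set (v S j) {1..s j}) = (\<Prod>j\<in>J. if j \<in> S
        then L2_set (\<lambda>x. dA j x k) {1..s j} else L2_set (\<lambda>x. Ap j x k) {1..s j})"
      by (rule prod.cong) (simp_all add: v_def)
    also have "\<dots> \<le> 2 ^ card J * \<epsilon>\<^sup>2 * P"
      unfolding P_def using S J \<epsilon> dnorm pnorm by (intro perturbation_term_norm_le) auto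
    also have "\<dots> \<le> 2 ^ N * \<epsilon>\<^sup>2 * P"
      using J P by (intro mult_right_mono power_increasing) auto
    finally have "(\<Prod>j\<in>J. L2_set (v S j) {1..s j}) \<le> 2 ^ N * \<epsilon>\<^sup>2 * P" .
    then have "hi * (\<Prod>j\<in>J. L2_set (v S j) {1..s j}) \<le> hi * (2 ^ N * \<epsilon>\<^sup>2 * P)"
      using lohi by (intro mult_left_mono)
    with upper_n[of "v S"] show ?thesis by (simp add: mode_norm_def J_def mult_ac)
  qed
  have "L2_set (\<lambda>y. pp_mttkrp_col N s X Ap dA n k y - mttkrp_col N s X A n k y) {1..s n}
      = L2_set (\<lambda>y. mttkrp_col N s X A n k y - pp_mttkrp_col N s X Ap dA n k y) {1..s n}"
    by (simp add: L2_set_def power2_commute)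
  also have "\<dots> \<le> (\<Sum>S\<in>{S \<in> Pow J. 2 \<le> card S}.
      L2_set (\<lambda>y. tensor_contract s X J (v S) (\<lambda>l\<in>{n}. y)) {1..s n})"
    unfolding error by (rule L2_set_sum_le)
  also have "\<dots> \<le> of_nat (card {S \<in> Pow J. 2 \<le> card S}) * (2 ^ N * (hi * \<epsilon>\<^sup>2 * P))"
    using upper by (rule sum_bounded_above)
  also have "\<dots> \<le> 2 ^ N * (2 ^ N * (hi * \<epsilon>\<^sup>2 * P))"
  proof (rule mult_right_mono)
    have "card {S \<in> Pow J. 2 \<le> card S} \<le> card (Pow J)" using J by (intro card_mono) auto
    also have "\<dots> \<le> 2 ^ N" using J by (simp add: card_Pow)
    finally show "real (card {S \<in> Pow J. 2 \<le> card S}) \<le> 2 ^ N"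
      by (metis of_nat_le_iff of_nat_numeral of_nat_power)
  qed (use lohi P in simp)
  also have "\<dots> = 4 ^ N * (hi * \<epsilon>\<^sup>2 * P)"
    by (simp flip: power_mult_distrib mult.assoc)
  finally have num: "L2_set (\<lambda>y. pp_mttkrp_col N s X Ap dA n k y - mttkrp_col N s X A n k y) {1..s n}
      \<le> 4 ^ N * (hi * \<epsilon>\<^sup>2 * P)" .
  have loP: "0 < lo * P" using lohi P by simp
  show "nonzero_vec (s n) (mttkrp_col N s X A n k)"
    using lower loP by (simp add: nonzero_vec_iff_L2_set_pos)
  have "L2_set (\<lambda>y. pp_mttkrp_col N s X Ap dA n k y - mttkrp_col N s X A n k y) {1..s n}
      / L2_set (mttkrp_col N s X A n k) {1..s n} \<le> 4 ^ N * (hi * \<epsilon>\<^sup>2 * P) / (lo * P)"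
    using num lower loP lohi P by (intro frac_le) auto
  \<comment> \<open>The product \<open>P\<close> of column norms cancels and leaves
    \<open>hi / lo\<close>, the condition number.\<close>
  also have "\<dots> = 4 ^ N * \<epsilon>\<^sup>2 * (hi / lo)" using P by simp
  finally show "ereal (L2_set (\<lambda>y. pp_mttkrp_col N s X Ap dA n k y - mttkrp_col N s X A n k y) {1..s n}
      / L2_set (mttkrp_col N s X A n k) {1..s n}) \<le> ereal (4 ^ N * \<epsilon>\<^sup>2) * tensor_cond N s X"
    by (simp add: cond)
qed

end
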